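(* Let $n$ be a positive integer. Then, for all complex numbers $x,y$ (and either choice of the square root), $$\sum_{k\ge 0}\sum_{p=0}^{n}\binom{n}{p}_k x^p y^k=2^{-n}\Big[\Big((1+x)(1+y)+\sqrt{(1+x)^2(1+y)^2-4x(1+y)}\Big)^n+\Big((1+x)(1+y)-\sqrt{(1+x)^2(1+y)^2-4x(1+y)}\Big)^n\Big].$$ (Only finitely many terms on the left are nonzero, so this is an identity of polynomials in $x$ and $y$.)
   Context: For $a$ a number and $r\ge 0$ an integer, $(a)_r=a(a+1)\cdots(a+r-1)$ denotes the raising factorial, with $(a)_0=1$. For integers $n\ge 1$, $0\le p\le n$, $k\ge 0$, define $$\binom{n}{p}_k=\binom{n}{k}\;{}_3F_2\!\left[\begin{matrix}1-k,\,-p,\,p-n\\ 1-n,\,1\end{matrix};1\right]=\binom{n}{k}\sum_{r=0}^{\min(p,n-p)}\frac{(1-k)_r\,(-p)_r\,(p-n)_r}{(1-n)_r\,(1)_r\,r!}.$$ The sum is finite because $(-p)_r(p-n)_r=0$ for $r>\min(p,n-p)$, and the denominators are nonzero in the stated range. Here $\binom{n}{k}$ is the usual binomial coefficient, equal to $0$ for $k>n$; hence $\binom{n}{p}_k=0$ for $k>n$. *)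

theory Defs
  imports Complex_Main
begin

text \<open>
  The terminating hypergeometric form of the generalised binomial coefficient, meaningful for
  \<open>1 \<le> n\<close> and \<open>p \<le> n\<close>. The \<open>3F2\<close> series has the
  non-positive lower parameter \<open>1 - n\<close>, so it is read as the finite sum up to
  \<open>min p (n - p)\<close>; there \<open>r < n\<close>, hence the denominators do not vanish.
  The parameters \<open>1 - k\<close>, \<open>p - n\<close>, \<open>1 - n\<close> are formed in the
  field, not by truncated subtraction.
\<close>

definition gen_binomial :: "nat \<Rightarrow> nat \<Rightarrow> nat \<Rightarrow> 'a::field_char_0" where
  "gen_binomial n p k = of_nat (n choose k) *
     (\<Sum>r = 0..min p (n - p).
        (pochhammer (1 - of_nat k) r * pochhammer (- of_nat p) r * pochhammer (of_nat p - of_nat n) r)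
        / (pochhammer (1 - of_nat n) r * pochhammer 1 r * fact r))"

lemma gen_binomial_eq_0: "n < k \<Longrightarrow> gen_binomial n p k = 0"
  by (simp add: gen_binomial_def)

lemma gen_binomial_denominator_nonzero:
  assumes "1 \<le> n" "p \<le> n" "r \<le> min p (n - p)"
  shows "pochhammer (1 - of_nat n) r * pochhammer 1 r * fact r \<noteq> (0 :: 'a::field_char_0)"
proof -
  have "r < n" using assms by linarith
  have "pochhammer (1 - of_nat n :: 'a) r \<noteq> 0"
  proof
    assume "pochhammer (1 - of_nat n :: 'a) r = 0"
    then obtain j where "j < r" "1 - of_nat n = - (of_nat j :: 'a)"
      by (auto simp: pochhammer_eq_0_iff)
    then have "of_nat (Suc j) = (of_nat n :: 'a)" by (simp add: algebra_simps)
    then have "Suc j = n" by (simp only: of_nat_eq_iff)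
    with \<open>j < r\<close> \<open>r < n\<close> show False by simp
  qed
  then show ?thesis by (simp add: pochhammer_fact [symmetric])
qed

end

theory Submission
  imports Defs
begin

text \<open>
  Summing the defining series over \<open>r\<close> with the Vandermonde convolution, after the ratio
  \<open>(1 - k)\<^sub>r / (1 - n)\<^sub>r\<close> has been written as an \<open>r\<close>-th finite difference in
  \<open>n\<close>, turns \<open>gen_binomial n p k\<close> into a sum over \<open>i\<close> whose dependence on \<open>k\<close> is
  only through \<open>n - i choose k\<close>. The binomial theorem in \<open>y\<close> and in \<open>x\<close> then gives the
  terms of the Girard--Waring expansion of \<open>A ^ n + B ^ n\<close>, where
  \<open>A + B = (1 + x) * (1 + y)\<close> and \<open>A * B = x * (1 + y)\<close>.
\<close>

section \<open>Pochhammer ratios as finite differences\<close>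

lemma pochhammer_minus_of_nat_eq_choose:
  "pochhammer (- of_nat p) r = ((-1) ^ r * fact r * of_nat (p choose r) :: 'a::field_char_0)"
  by (simp add: binomial_gbinomial gbinomial_pochhammer)

lemma pochhammer_one_minus_nonzero:
  assumes "r < n"
  shows "pochhammer (1 - of_nat n) r \<noteq> (0 :: 'a::field_char_0)"
proof
  assume "pochhammer (1 - of_nat n :: 'a) r = 0"
  then obtain j where "j < r" "1 - of_nat n = - (of_nat j :: 'a)"
    by (auto simp: pochhammer_eq_0_iff)
  then have "of_nat (Suc j) = (of_nat n :: 'a)" by (simp add: algebra_simps)
  then have "Suc j = n" by (simp only: of_nat_eq_iff)
  with \<open>j < r\<close> assms show False by simp
qed

text \<open>The left side is the \<open>r\<close>-th backward difference at \<open>n\<close> of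
  \<open>j \<mapsto> (j choose k) / j\<close>. Induction on \<open>r\<close> works because the right
  side obeys the same difference recurrence; \<open>n\<close> stays arbitrary, since each step uses
  the values at \<open>n\<close> and \<open>n - 1\<close>. The bound \<open>r < n\<close> keeps
  every denominator nonzero.\<close>

lemma choose_pochhammer_ratio:
  assumes "r < n"
  shows "(\<Sum>i\<le>r. (-1) ^ i * of_nat (r choose i) * of_nat ((n - i) choose k) / of_nat (n - i))
       = (of_nat (n choose k) * pochhammer (1 - of_nat k) r
            / (of_nat n * pochhammer (1 - of_nat n) r) :: 'a::field_char_0)"
  using assms
proof (induction r arbitrary: n)
  case 0
  then show ?case by simp
next
  case (Suc r)
  obtain m where n: "n = Suc m" and m: "r < m"
    using Suc.prems by (cases n) auto
  define g :: "nat \<Rightarrow> 'a" where "g j = of_nat (j choose k) / of_nat j" for j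
  have "(\<Sum>i\<le>Suc r. (-1) ^ i * of_nat (Suc r choose i) * g (n - i))
      = g n + (\<Sum>i\<le>r. (-1) ^ Suc i * of_nat (Suc r choose Suc i) * g (m - i))"
    by (subst sum.atMost_Suc_shift) (simp add: n)
  \<comment> \<open>Pascal's rule splits the difference of order \<open>Suc r\<close> into the two
    differences of order \<open>r\<close> at \<open>n\<close> and at
    \<open>m = n - 1\<close>.\<close>
  also have "\<dots> = (g n + (\<Sum>i\<le>r. (-1) ^ Suc i * of_nat (r choose Suc i) * g (m - i)))
      - (\<Sum>i\<le>r. (-1) ^ i * of_nat (r choose i) * g (m - i))"
    by (simp add: algebra_simps sum.distrib sum_subtractf sum_negf)
  also have "g n + (\<Sum>i\<le>r. (-1) ^ Suc i * of_nat (r choose Suc i) * g (m - i))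
      = (\<Sum>i\<le>Suc r. (-1) ^ i * of_nat (r choose i) * g (n - i))"
    by (subst sum.atMost_Suc_shift) (simp add: n)
  also have "\<dots> = (\<Sum>i\<le>r. (-1) ^ i * of_nat (r choose i) * g (n - i))"
    by simp
  finally have diff: "(\<Sum>i\<le>Suc r. (-1) ^ i * of_nat (Suc r choose i) * g (n - i))
      = (\<Sum>i\<le>r. (-1) ^ i * of_nat (r choose i) * g (n - i))
        - (\<Sum>i\<le>r. (-1) ^ i * of_nat (r choose i) * g (m - i))" .
  let ?N = "of_nat n :: 'a" and ?K = "of_nat k :: 'a" and ?R = "of_nat r :: 'a"
  define q where "q = pochhammer (1 - ?K) r"
  define u where "u = pochhammer (1 - ?N) r"
  define v where "v = pochhammer (1 - of_nat m :: 'a) r"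
  have un: "u \<noteq> 0" and vn: "v \<noteq> 0"
    using m unfolding u_def v_def n by (auto intro!: pochhammer_one_minus_nonzero simp del: of_nat_Suc)
  have Nm: "?N = of_nat m + 1" by (simp add: n)
  \<comment> \<open>Both sides are \<open>pochhammer (1 - ?N) (Suc r)\<close>, with the last factor
    split off on the left and the first on the right.\<close>
  have uv: "u * (1 - ?N + ?R) = (1 - ?N) * v"
    using pochhammer_Suc[of "1 - ?N" r] pochhammer_rec[of "1 - ?N" r]
    by (simp add: u_def v_def Nm)
  have pS: "pochhammer (1 - ?N) (Suc r) = (1 - ?N) * v"
    using pochhammer_rec[of "1 - ?N" r] by (simp add: v_def Nm)
  have N0: "?N \<noteq> 0" by (simp add: n del: of_nat_Suc)
  have M0: "?N - 1 \<noteq> 0" using m by (simp add: n)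
  have R0: "1 - ?N + ?R \<noteq> 0"
    using uv vn M0 by auto
  have ch: "of_nat (m choose k) * ?N = of_nat (n choose k) * (?N - ?K)"
  proof (cases "k \<le> n")
    case True
    have "(n - k) * (n choose k) = n * (m choose k)"
      using binomial_absorb_comp[of n k] by (simp add: n)
    then have "of_nat (n - k) * of_nat (n choose k) = (?N * of_nat (m choose k) :: 'a)"
      by (metis of_nat_mult)
    with True show ?thesis by (simp add: of_nat_diff mult.commute)
  next
    case False
    then show ?thesis by (simp add: n binomial_eq_0)
  qed
  have mc: "of_nat (m choose k) = of_nat (n choose k) * (?N - ?K) / ?N"
    using ch N0 by (simp add: field_simps)
  have ue: "u = (1 - ?N) * v / (1 - ?N + ?R)"
    using uv R0 by (simp add: field_simps)
  have M1: "1 - ?N \<noteq> 0" using M0 by auto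
  \<comment> \<open>Over a common denominator the numerators contribute \<open>1 - ?N + ?R\<close>
    and \<open>?N - ?K\<close>. Their sum \<open>1 - ?K + ?R\<close> is exactly the factor that
    extends \<open>q\<close> to \<open>pochhammer (1 - ?K) (Suc r)\<close>.\<close>
  have "of_nat (n choose k) * q / (?N * u) - of_nat (m choose k) * q / ((?N - 1) * v)
      = of_nat (n choose k) * q * ((1 - ?N + ?R) + (?N - ?K)) / (?N * ((1 - ?N) * v))"
  proof -
    have a: "of_nat (n choose k) * q / (?N * u)
        = of_nat (n choose k) * q * (1 - ?N + ?R) / (?N * ((1 - ?N) * v))"
      using N0 M1 vn R0 by (simp add: ue)
    have d: "(?N - 1) * v = - ((1 - ?N) * v)" by (simp add: algebra_simps)
    have b: "of_nat (m choose k) * q / ((?N - 1) * v)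
        = - (of_nat (n choose k) * q * (?N - ?K) / (?N * ((1 - ?N) * v)))"
      unfolding d mc by simp
    show ?thesis unfolding a b diff_minus_eq_add distrib_left[of "of_nat (n choose k) * q"]
      by (rule add_divide_distrib [symmetric])
  qed
  also have "(1 - ?N + ?R) + (?N - ?K) = 1 - ?K + ?R" by simp
  finally have "of_nat (n choose k) * q / (?N * u) - of_nat (m choose k) * q / ((?N - 1) * v)
      = of_nat (n choose k) * pochhammer (1 - ?K) (Suc r) / (?N * pochhammer (1 - ?N) (Suc r))"
    unfolding pS pochhammer_Suc[of "1 - ?K"] q_def by (simp add: mult.assoc)
  moreover have "?N - 1 = of_nat m" by (simp add: Nm)
  ultimately show ?case
    using Suc.IH[OF m] Suc.IH[of n] m diff n
    by (simp add: g_def q_def u_def v_def)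
qed

section \<open>Summation over the hypergeometric index\<close>

text \<open>Choosing the \<open>i\<close>-subset first turns
  \<open>(p choose r) * (r choose i)\<close> into
  \<open>(p choose i) * ((p - i) choose (p - r))\<close>. Now \<open>r\<close> and
  \<open>p - r\<close> are complementary lower indices, so Vandermonde applies once the range is
  extended to \<open>r \<le> p\<close> by zero terms.\<close>

lemma sum_choose_choose_choose:
  assumes "p \<le> n"
  shows "(\<Sum>r\<le>min p (n - p). (p choose r) * ((n - p) choose r) * (r choose i))
       = (p choose i) * ((n - i) choose p)"
proof (cases "i \<le> p")
  case True
  have "(\<Sum>r\<le>min p (n - p). (p choose r) * ((n - p) choose r) * (r choose i))
      = (\<Sum>r\<le>p. (p choose r) * ((n - p) choose r) * (r choose i))"
    by (rule sum.mono_neutral_left) auto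
  also have "\<dots> = (\<Sum>r\<le>p. (p choose i) * (((n - p) choose r) * ((p - i) choose (p - r))))"
  proof (rule sum.cong)
    fix r assume "r \<in> {..p}"
    then have r: "r \<le> p" by simp
    have "(p choose r) * (r choose i) = (p choose i) * ((p - i) choose (p - r))"
    proof (cases "i \<le> r")
      case le: True
      have "(p choose r) * (r choose i) = (p choose i) * ((p - i) choose (r - i))"
        using choose_mult[OF le r] .
      also have "(p - i) choose (r - i) = (p - i) choose (p - r)"
        using le r by (subst binomial_symmetric) auto
      finally show ?thesis .
    next
      case False
      with True r show ?thesis by (simp add: binomial_eq_0)
    qed
    then show "(p choose r) * ((n - p) choose r) * (r choose i)
        = (p choose i) * (((n - p) choose r) * ((p - i) choose (p - r)))"
      by (simp add: ac_simps)
  qed simp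
  also have "\<dots> = (p choose i) * (((n - p) + (p - i)) choose p)"
    by (simp only: vandermonde flip: sum_distrib_left)
  also have "(n - p) + (p - i) = n - i" using True assms by simp
  finally show ?thesis .
next
  case False
  then show ?thesis by (auto simp: binomial_eq_0 intro!: sum.neutral)
qed

lemma gen_binomial_eq_sum_choose:
  assumes "1 \<le> n" "p \<le> n"
  shows "gen_binomial n p k = (\<Sum>i<n. (-1) ^ i * (of_nat n / of_nat (n - i)) *
    of_nat ((n - i) choose k) * of_nat ((p choose i) * ((n - i) choose p)) :: 'a::field_char_0)"
proof -
  let ?w = "\<lambda>i. (-1) ^ i * (of_nat n / of_nat (n - i)) * of_nat ((n - i) choose k) :: 'a"
  let ?R = "{..min p (n - p)}"
  have np: "of_nat p - of_nat n = (- of_nat (n - p) :: 'a)"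
    using assms by (simp add: of_nat_diff)
  have "gen_binomial n p k = (\<Sum>r\<in>?R. of_nat (n choose k) *
      (pochhammer (1 - of_nat k) r / pochhammer (1 - of_nat n) r) *
      of_nat ((p choose r) * ((n - p) choose r)) :: 'a)"
    unfolding gen_binomial_def np pochhammer_minus_of_nat_eq_choose sum_distrib_left atLeast0AtMost
  proof (rule sum.cong)
    fix r
    have "(-1) ^ r * (-1) ^ r = (1 :: 'a)" by (simp flip: power_mult_distrib)
    then show "of_nat (n choose k) * (pochhammer (1 - of_nat k) r
          * ((-1) ^ r * fact r * of_nat (p choose r))
          * ((-1) ^ r * fact r * of_nat ((n - p) choose r))
          / (pochhammer (1 - of_nat n) r * pochhammer 1 r * fact r))
      = (of_nat (n choose k) * (pochhammer (1 - of_nat k) r / pochhammer (1 - of_nat n) r) *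
          of_nat ((p choose r) * ((n - p) choose r)) :: 'a)"
      by (simp flip: pochhammer_fact)
  qed simp
  also have "\<dots> = (\<Sum>r\<in>?R. (\<Sum>i<n. ?w i * of_nat (r choose i)) *
      of_nat ((p choose r) * ((n - p) choose r)))"
  proof (rule sum.cong)
    fix r assume "r \<in> ?R"
    then have r: "r < n" using assms by auto
    \<comment> \<open>Inserting \<open>n / n\<close> makes the finite-difference formula applicable;
      this \<open>n\<close> is the numerator of the weight \<open>n / (n - i)\<close>.\<close>
    have "of_nat (n choose k) * (pochhammer (1 - of_nat k) r / pochhammer (1 - of_nat n) r)
        = of_nat n * (of_nat (n choose k) * pochhammer (1 - of_nat k) r
            / (of_nat n * pochhammer (1 - of_nat n) r) :: 'a)"
      using assms by simp
    also have "\<dots> = (\<Sum>i\<le>r. ?w i * of_nat (r choose i))"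
      unfolding choose_pochhammer_ratio[OF r, symmetric] sum_distrib_left
      by (simp add: ac_simps)
    \<comment> \<open>Padding with zero terms makes the inner range independent of \<open>r\<close>,
      so that the two sums can be swapped.\<close>
    also have "\<dots> = (\<Sum>i<n. ?w i * of_nat (r choose i))"
      using r by (intro sum.mono_neutral_left) (auto simp: binomial_eq_0)
    finally show "of_nat (n choose k) *
        (pochhammer (1 - of_nat k) r / pochhammer (1 - of_nat n) r) *
        of_nat ((p choose r) * ((n - p) choose r))
      = (\<Sum>i<n. ?w i * of_nat (r choose i)) * of_nat ((p choose r) * ((n - p) choose r))"
      by simp
  qed simp
  also have "\<dots> = (\<Sum>i<n. ?w i *
      of_nat (\<Sum>r\<in>?R. (p choose r) * ((n - p) choose r) * (r choose i)))"
    unfolding sum_distrib_right of_nat_sum sum_distrib_left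
    by (subst sum.swap) (simp add: ac_simps)
  finally show ?thesis
    by (simp only: sum_choose_choose_choose[OF assms(2)])
qed

lemma sum_choose_choose_power:
  fixes x :: "'a::comm_semiring_1"
  shows "(\<Sum>p\<le>m. of_nat ((p choose i) * (m choose p)) * x ^ p)
       = of_nat (m choose i) * x ^ i * (1 + x) ^ (m - i)"
proof (cases "i \<le> m")
  case True
  have "(\<Sum>p\<le>m. of_nat ((p choose i) * (m choose p)) * x ^ p)
      = (\<Sum>p\<in>{i..m}. of_nat ((p choose i) * (m choose p)) * x ^ p)"
    by (rule sum.mono_neutral_right) (auto simp: binomial_eq_0)
  also have "\<dots> = (\<Sum>p\<in>{i..m}. of_nat (m choose i) * x ^ i * (of_nat ((m - i) choose (p - i)) * x ^ (p - i)))"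
  proof (rule sum.cong)
    fix p assume p: "p \<in> {i..m}"
    then have "(p choose i) * (m choose p) = (m choose i) * ((m - i) choose (p - i))"
      using choose_mult[of i p m] by (simp add: mult.commute)
    moreover have "x ^ p = x ^ i * x ^ (p - i)"
      using p by (simp flip: power_add)
    ultimately show "of_nat ((p choose i) * (m choose p)) * x ^ p
        = of_nat (m choose i) * x ^ i * (of_nat ((m - i) choose (p - i)) * x ^ (p - i))"
      by (simp add: ac_simps)
  qed simp
  also have "\<dots> = (\<Sum>q\<le>m - i. of_nat (m choose i) * x ^ i * (of_nat ((m - i) choose q) * x ^ q))"
    by (rule sum.reindex_bij_witness[of _ "\<lambda>q. q + i" "\<lambda>p. p - i"]) (use True in auto)
  also have "\<dots> = of_nat (m choose i) * x ^ i * (x + 1) ^ (m - i)"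
    by (simp add: binomial_ring sum_distrib_left)
  finally show ?thesis by (simp add: add.commute)
next
  case False
  then show ?thesis by (auto simp: binomial_eq_0 intro!: sum.neutral)
qed

section \<open>Lucas polynomials and the Girard-Waring formula\<close>

text \<open>For \<open>S = A + B\<close> and \<open>P = A * B\<close> this is the complete
  homogeneous symmetric polynomial of degree \<open>n\<close> in \<open>A\<close> and
  \<open>B\<close>, the Lucas polynomial of index \<open>n + 1\<close>. Where the subtraction
  \<open>n - 2 * i\<close> truncates, the binomial coefficient is zero.\<close>

definition lucas_U :: "'a::comm_ring_1 \<Rightarrow> 'a \<Rightarrow> nat \<Rightarrow> 'a" where
  "lucas_U S P n = (\<Sum>i\<le>n. (-1) ^ i * of_nat ((n - i) choose i) * S ^ (n - 2 * i) * P ^ i)"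

lemma lucas_U_rec:
  "lucas_U S P (Suc (Suc n)) = S * lucas_U S P (Suc n) - P * lucas_U S P n"
proof -
  let ?t = "\<lambda>n i. (-1) ^ i * of_nat ((n - i) choose i) * S ^ (n - 2 * i) * P ^ i"
  \<comment> \<open>After the shift the top term \<open>i = Suc n\<close> carries
    \<open>0 choose Suc (Suc n)\<close> and drops out.\<close>
  have "lucas_U S P (Suc (Suc n)) = S ^ Suc (Suc n) + (\<Sum>i\<le>n. ?t (Suc (Suc n)) (Suc i))"
    unfolding lucas_U_def by (subst sum.atMost_Suc_shift) simp
  also have "(\<Sum>i\<le>n. ?t (Suc (Suc n)) (Suc i)) = (\<Sum>i\<le>n. S * ?t (Suc n) (Suc i) - P * ?t n i)"
  proof (rule sum.cong)
    fix i assume "i \<in> {..n}"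
    then have i: "i \<le> n" by simp
    \<comment> \<open>The powers of \<open>S\<close> disagree only when
      \<open>2 * i \<ge> n\<close>, and there the binomial coefficient vanishes.\<close>
    have pw: "of_nat ((n - i) choose Suc i) * S ^ (n - 2 * i)
        = of_nat ((n - i) choose Suc i) * (S * S ^ (n - Suc (2 * i)))"
    proof (cases "Suc i \<le> n - i")
      case True
      then have "n - 2 * i = Suc (n - Suc (2 * i))" by simp
      then show ?thesis by simp
    next
      case False
      then show ?thesis by (simp add: binomial_eq_0)
    qed
    have "?t (Suc (Suc n)) (Suc i)
        = (-1) ^ Suc i * (of_nat ((n - i) choose i) * S ^ (n - 2 * i)
            + of_nat ((n - i) choose Suc i) * S ^ (n - 2 * i)) * P ^ Suc i"
      using i by (simp add: Suc_diff_le algebra_simps)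
    also have "\<dots> = S * ?t (Suc n) (Suc i) - P * ?t n i"
      unfolding pw by (simp add: algebra_simps)
    finally show "?t (Suc (Suc n)) (Suc i) = S * ?t (Suc n) (Suc i) - P * ?t n i" .
  qed simp
  also have "S ^ Suc (Suc n) + \<dots> = S * (S ^ Suc n + (\<Sum>i\<le>n. ?t (Suc n) (Suc i))) - P * lucas_U S P n"
    by (simp add: lucas_U_def sum_subtractf sum_distrib_left algebra_simps)
  also have "S ^ Suc n + (\<Sum>i\<le>n. ?t (Suc n) (Suc i)) = lucas_U S P (Suc n)"
    unfolding lucas_U_def by (subst sum.atMost_Suc_shift) simp
  finally show ?thesis .
qed

text \<open>Both sides satisfy the recurrence with characteristic roots \<open>A\<close> and
  \<open>B\<close>, so two initial values suffice.\<close>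

lemma power_sum_eq_lucas_U:
  fixes A B :: "'a::comm_ring_1"
  shows "A ^ Suc (Suc n) + B ^ Suc (Suc n)
       = lucas_U (A + B) (A * B) (Suc (Suc n)) - A * B * lucas_U (A + B) (A * B) n"
proof (induction n rule: induct_nat_012)
  case 0
  show ?case by (simp add: lucas_U_def power2_eq_square algebra_simps)
next
  case 1
  show ?case by (simp add: lucas_U_def eval_nat_numeral algebra_simps)
next
  case (ge2 n)
  let ?U = "lucas_U (A + B) (A * B)" and ?T = "\<lambda>m. A ^ m + B ^ m"
  have "?T (Suc (Suc (Suc (Suc n)))) = (A + B) * ?T (Suc (Suc (Suc n))) - A * B * ?T (Suc (Suc n))"
    by (simp add: algebra_simps)
  also have "\<dots> = ?U (Suc (Suc (Suc (Suc n)))) - A * B * ?U (Suc (Suc n))"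
    unfolding ge2 lucas_U_rec[of _ _ "Suc (Suc n)"] lucas_U_rec[of _ _ n]
    by (simp add: lucas_U_rec[of _ _ "Suc n"] lucas_U_rec[of _ _ n] algebra_simps)
  finally show ?case .
qed

theorem girard_waring_two:
  fixes A B :: "'a::field_char_0"
  assumes "1 \<le> n"
  shows "A ^ n + B ^ n = (\<Sum>i<n. (-1) ^ i * (of_nat n / of_nat (n - i)) *
           of_nat ((n - i) choose i) * (A + B) ^ (n - 2 * i) * (A * B) ^ i)"
proof (cases "n = 1")
  case True
  then show ?thesis by simp
next
  case False
  then obtain m where n: "n = Suc (Suc m)"
    using assms by (metis One_nat_def not_one_le_zero not0_implies_Suc)
  let ?S = "A + B" and ?P = "A * B"
  let ?t = "\<lambda>n i. (-1) ^ i * of_nat ((n - i) choose i) * ?S ^ (n - 2 * i) * ?P ^ i"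
  let ?c = "\<lambda>i. (-1) ^ i * (of_nat n / of_nat (n - i)) *
           of_nat ((n - i) choose i) * ?S ^ (n - 2 * i) * ?P ^ i"
  \<comment> \<open>With \<open>d = n - Suc i\<close>, absorption gives
    \<open>(d - 1 choose i) = (i + 1) / d * (d choose i + 1)\<close>. Adding
    \<open>d choose i + 1\<close> produces the factor \<open>(d + i + 1) / d = n / d\<close>, the
    Girard-Waring weight.\<close>
  have step: "?t n (Suc i) - ?P * ?t m i = ?c (Suc i)" if "i \<le> m" for i
  proof -
    let ?d = "Suc m - i"
    have d: "of_nat ?d \<noteq> (0 :: 'a)" using that by (simp del: of_nat_diff)
    have dd: "?d = Suc (m - i)" using that by simp
    have "of_nat (Suc i) * of_nat (?d choose Suc i) = (of_nat ?d * of_nat ((m - i) choose i) :: 'a)"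
      unfolding dd by (metis binomial_absorption of_nat_mult diff_Suc_1)
    then have e: "of_nat ((m - i) choose i) = (of_nat (Suc i) * of_nat (?d choose Suc i) / of_nat ?d :: 'a)"
      using d by (simp add: field_simps del: of_nat_diff of_nat_Suc)
    have f: "(of_nat n :: 'a) = of_nat ?d + of_nat (Suc i)"
      using that unfolding n by (simp only: flip: of_nat_add) simp
    have "of_nat (?d choose Suc i) + of_nat ((m - i) choose i)
        = (of_nat n / of_nat ?d * of_nat (?d choose Suc i) :: 'a)"
      using d unfolding e f by (simp add: field_simps del: of_nat_diff of_nat_Suc)
    moreover have "?t n (Suc i) - ?P * ?t m i = (-1) ^ Suc i *
        (of_nat (?d choose Suc i) + of_nat ((m - i) choose i)) * ?S ^ (m - 2 * i) * ?P ^ Suc i"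
      by (simp add: n algebra_simps del: binomial_Suc_Suc)
    ultimately show ?thesis by (simp add: n mult.assoc)
  qed
  have "A ^ n + B ^ n = lucas_U ?S ?P n - ?P * lucas_U ?S ?P m"
    unfolding n by (rule power_sum_eq_lucas_U)
  also have "lucas_U ?S ?P n = ?S ^ n + (\<Sum>i\<le>m. ?t n (Suc i))"
    unfolding lucas_U_def n by (subst sum.atMost_Suc_shift) simp
  also have "\<dots> - ?P * lucas_U ?S ?P m = ?S ^ n + (\<Sum>i\<le>m. ?t n (Suc i) - ?P * ?t m i)"
    unfolding lucas_U_def by (simp add: sum_subtractf sum_distrib_left)
  also have "(\<Sum>i\<le>m. ?t n (Suc i) - ?P * ?t m i) = (\<Sum>i\<le>m. ?c (Suc i))"
    by (rule sum.cong[OF refl], rule step) simp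
  also have "?S ^ n + (\<Sum>i\<le>m. ?c (Suc i)) = (\<Sum>i<n. ?c i)"
    unfolding n lessThan_Suc_atMost sum.atMost_Suc_shift[of _ m] by (simp del: of_nat_Suc)
  finally show ?thesis .
qed

section \<open>The generating function\<close>

text \<open>Fixing only the sum and product of \<open>A\<close> and \<open>B\<close> avoids square
  roots, so the identity holds over any field of characteristic zero. For fixed \<open>i\<close> the
  double sum factors into a sum over \<open>k\<close> and a sum over \<open>p\<close>.\<close>

theorem gen_binomial_generating_function:
  fixes A B x y :: "'a::field_char_0"
  assumes n: "1 \<le> n"
    and sum: "A + B = (1 + x) * (1 + y)" and prod: "A * B = x * (1 + y)"
  shows "(\<Sum>k\<le>n. \<Sum>p\<le>n. gen_binomial n p k * x ^ p * y ^ k) = A ^ n + B ^ n"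
proof -
  let ?w = "\<lambda>i. (-1) ^ i * (of_nat n / of_nat (n - i)) :: 'a"
  let ?f = "\<lambda>i k. of_nat ((n - i) choose k) * y ^ k"
  let ?g = "\<lambda>i p. of_nat ((p choose i) * ((n - i) choose p)) * x ^ p"
  have f: "(\<Sum>k\<le>n. ?f i k) = (1 + y) ^ (n - i)" for i
  proof -
    have "(\<Sum>k\<le>n. ?f i k) = (\<Sum>k\<le>n - i. ?f i k)"
      by (rule sum.mono_neutral_right) (auto simp: binomial_eq_0)
    then show ?thesis using binomial_ring[of y 1 "n - i"] by (simp add: add.commute)
  qed
  have g: "(\<Sum>p\<le>n. ?g i p) = of_nat ((n - i) choose i) * x ^ i * (1 + x) ^ (n - 2 * i)" for i
  proof -
    have "(\<Sum>p\<le>n. ?g i p) = (\<Sum>p\<le>n - i. ?g i p)"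
      by (rule sum.mono_neutral_right) (auto simp: binomial_eq_0)
    also have "\<dots> = of_nat ((n - i) choose i) * x ^ i * (1 + x) ^ (n - i - i)"
      by (rule sum_choose_choose_power)
    also have "n - i - i = n - 2 * i" by simp
    finally show ?thesis .
  qed
  have "(\<Sum>k\<le>n. \<Sum>p\<le>n. gen_binomial n p k * x ^ p * y ^ k)
      = (\<Sum>k\<le>n. \<Sum>p\<le>n. \<Sum>i<n. ?w i * (?f i k * ?g i p))"
    by (intro sum.cong refl)
      (simp add: gen_binomial_eq_sum_choose[OF n] sum_distrib_left sum_distrib_right ac_simps)
  also have "\<dots> = (\<Sum>i<n. \<Sum>k\<le>n. \<Sum>p\<le>n. ?w i * (?f i k * ?g i p))"
    by (subst (2) sum.swap, subst sum.swap) simp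
  also have "\<dots> = (\<Sum>i<n. ?w i * ((\<Sum>k\<le>n. ?f i k) * (\<Sum>p\<le>n. ?g i p)))"
    by (simp only: sum_product) (simp only: sum_distrib_left)
  also have "\<dots> = (\<Sum>i<n. ?w i * of_nat ((n - i) choose i) * (A + B) ^ (n - 2 * i) * (A * B) ^ i)"
  proof (rule sum.cong[OF refl])
    fix i
    show "?w i * ((\<Sum>k\<le>n. ?f i k) * (\<Sum>p\<le>n. ?g i p))
        = ?w i * of_nat ((n - i) choose i) * (A + B) ^ (n - 2 * i) * (A * B) ^ i"
    \<comment> \<open>If \<open>2 * i \<le> n\<close>, then \<open>(1 + y) ^ (n - i)\<close>
      supplies \<open>n - 2 * i\<close> factors to the powers of \<open>A + B\<close> and
      \<open>i\<close> factors to those of \<open>A * B\<close>. Otherwise both sides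
      vanish.\<close>
    proof (cases "i \<le> n - i")
      case True
      then have "n - i = n - 2 * i + i" by simp
      then have "(1 + y) ^ (n - i) = (1 + y) ^ (n - 2 * i) * (1 + y) ^ i"
        by (metis power_add)
      then show ?thesis
        unfolding f g sum prod power_mult_distrib by (simp only: ac_simps)
    next
      case False
      then show ?thesis unfolding f g by (simp add: binomial_eq_0)
    qed
  qed
  finally show ?thesis by (simp add: girard_waring_two[OF n])
qed

theorem theorem2:
  fixes n :: nat and x y s :: complex
  assumes "n \<ge> 1"
    and "s\<^sup>2 = (1 + x)\<^sup>2 * (1 + y)\<^sup>2 - 4 * x * (1 + y)"
  shows "(\<lambda>k. \<Sum>p = 0..n. gen_binomial n p k * x ^ p * y ^ k) sums
           (1 / 2 ^ n * (((1 + x) * (1 + y) + s) ^ n + ((1 + x) * (1 + y) - s) ^ n))"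
proof -
  \<comment> \<open>Halving absorbs the factor \<open>1 / 2 ^ n\<close>. The other choice of root
    replaces \<open>s\<close> by \<open>- s\<close> and merely swaps \<open>A\<close> and
    \<open>B\<close>.\<close>
  define A where "A = ((1 + x) * (1 + y) + s) / 2"
  define B where "B = ((1 + x) * (1 + y) - s) / 2"
  have "A + B = (1 + x) * (1 + y)" by (simp add: A_def B_def field_simps)
  moreover have "A * B = (((1 + x) * (1 + y))\<^sup>2 - s\<^sup>2) / 4"
    by (simp add: A_def B_def power2_eq_square algebra_simps)
  then have "A * B = x * (1 + y)"
    unfolding assms(2) by (simp add: power_mult_distrib)
  ultimately have "(\<Sum>k\<le>n. \<Sum>p\<le>n. gen_binomial n p k * x ^ p * y ^ k) = A ^ n + B ^ n"
    by (rule gen_binomial_generating_function[OF assms(1)])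
  also have "\<dots> = 1 / 2 ^ n * (((1 + x) * (1 + y) + s) ^ n + ((1 + x) * (1 + y) - s) ^ n)"
    by (simp add: A_def B_def power_divide flip: add_divide_distrib)
  finally have "(\<Sum>k\<le>n. \<Sum>p = 0..n. gen_binomial n p k * x ^ p * y ^ k)
      = 1 / 2 ^ n * (((1 + x) * (1 + y) + s) ^ n + ((1 + x) * (1 + y) - s) ^ n)"
    by (simp only: atLeast0AtMost)
  \<comment> \<open>The series is finite because \<open>gen_binomial n p k\<close> vanishes for
    \<open>k > n\<close>.\<close>
  moreover have "(\<lambda>k. \<Sum>p = 0..n. gen_binomial n p k * x ^ p * y ^ k) sums
      (\<Sum>k\<le>n. \<Sum>p = 0..n. gen_binomial n p k * x ^ p * y ^ k)"
    by (rule sums_finite) (auto simp: gen_binomial_eq_0)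
  ultimately show ?thesis by simp
qed

end
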